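(* Let $(X,d,m)$ be a PI space and let $E\subset X$ be a closed bounded $BV$-extension set. Then there exists $N$, depending only on $E$ and the constants in the doubling property and the Poincaré inequality, such that the following holds: for every finite Borel partition $\{E_i\}_{i=1}^M$ of $E$ satisfying $m(E_i)>0$ and $P_E(E_i,E)=0$ for all $1\le i\le M$, we have $M\le N$.
   Context: A metric measure space $(X,d,m)$: $(X,d)$ is complete and separable and $m$ is a nonnegative Borel measure finite on bounded sets. $\mathrm{lip}\,u(x)=\limsup_{y\to x}|u(y)-u(x)|/d(x,y)$ if $x$ is an accumulation point, $0$ otherwise. PI space: $m$ is doubling (there is $C_m>0$ with $0<m(B(x,2r))\le C_m\,m(B(x,r))<\infty$ for all $x\in X$, $r>0$) and a $(1,1)$-Poincaré inequality holds: there are $C>0$, $\lambda\ge1$ such that for every locally Lipschitz $u\colon X\to\mathbb{R}$, $x\in X$, $r>0$, $\frac{1}{m(B(x,r))}\int_{B(x,r)}|u-u_{B(x,r)}|\,dm\le \frac{Cr}{m(B(x,\lambda r))}\int_{B(x,\lambda r)}\mathrm{lip}\,u\,dm$, where $u_A$ is the average of $u$ over $A$. For $u\in L^1_{loc}(X)$ and $A$ open, $|Du|(A):=\inf\{\liminf_n\int_A \mathrm{lip}\,u_n\,dm : u_n\in \mathrm{Lip}_{loc}(A),\ u_n\to u \text{ in } L^1_{loc}(m|_A)\}$ ($\mathrm{Lip}_{loc}$: locally Lipschitz); for $B$ Borel, $|Du|(B):=\inf\{|Du|(A): A\supset B \text{ open}\}$. For $B$ Borel and $u\in L^1_{loc}(m|_B)$,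 $|Du|_B$ is the total variation of $u$ computed in $(X,d,m|_B)$. For Borel sets $F\subset B$ and $G$, $P_B(F,G):=|D\chi_F|_B(B\cap G)$; so $P_E(E_i,E)=|D\chi_{E_i}|_E(E)$. $BV(B):=\{u\in L^1(m|_B): |Du|_B(B)<\infty\}$ with norm $\|u\|_{BV(B)}=\|u\|_{L^1(m|_B)}+|Du|_B(B)$. A Borel set $E$ is a $BV$-extension set if there exist $C\ge1$ and a (not necessarily linear) map $T\colon BV(E)\to BV(X)$ with $Tu=u$ ($m$-a.e.) on $E$ and $\|Tu\|_{BV(X)}\le C\|u\|_{BV(E)}$ for every $u\in BV(E)$. *)

theory Defs
  imports "HOL-Analysis.Analysis"
begin

text \<open>
  The complete separable metric space \<open>(X, d)\<close> is a type of class \<open>polish_space\<close>.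
  Functions on a subset of \<open>X\<close> are represented by total functions; every
  definition below only uses their values on the relevant subset.
\<close>

definition metric_measure :: "'a::polish_space measure \<Rightarrow> bool" where
  "metric_measure m \<longleftrightarrow>
     sets m = sets borel \<and> (\<forall>A\<in>sets borel. bounded A \<longrightarrow> emeasure m A < \<infinity>)"

definition loc_lipschitz_on :: "'a::metric_space set \<Rightarrow> ('a \<Rightarrow> real) \<Rightarrow> bool" where
  "loc_lipschitz_on A u \<longleftrightarrow> (\<forall>x\<in>A. \<exists>r>0. \<exists>L. L-lipschitz_on (ball x r \<inter> A) u)"

definition lip :: "('a::metric_space \<Rightarrow> real) \<Rightarrow> 'a \<Rightarrow> ennreal" where
  "lip u x =
     (if x islimpt UNIV then Limsup (at x) (\<lambda>y. ennreal (\<bar>u y - u x\<bar> / dist y x)) else 0)"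

definition average :: "'a measure \<Rightarrow> 'a set \<Rightarrow> ('a \<Rightarrow> real) \<Rightarrow> real" where
  "average m A u = (LINT x:A|m. u x) / measure m A"

definition doubling :: "'a::metric_space measure \<Rightarrow> real \<Rightarrow> bool" where
  "doubling m Cm \<longleftrightarrow> Cm > 0 \<and>
     (\<forall>x. \<forall>r>0. 0 < emeasure m (ball x (2 * r)) \<and>
        emeasure m (ball x (2 * r)) \<le> ennreal Cm * emeasure m (ball x r) \<and>
        ennreal Cm * emeasure m (ball x r) < \<infinity>)"

text \<open>
  On a complete doubling space balls are relatively compact, so a locally Lipschitz
  \<open>u\<close> is integrable on balls and the Bochner integral in \<open>average\<close> is a genuine mean.
\<close>

definition poincare :: "'a::metric_space measure \<Rightarrow> real \<Rightarrow> real \<Rightarrow> bool" where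
  "poincare m C lam \<longleftrightarrow> C > 0 \<and> lam \<ge> 1 \<and>
     (\<forall>u x r. loc_lipschitz_on UNIV u \<and> r > 0 \<longrightarrow>
        (\<integral>\<^sup>+y\<in>ball x r. ennreal \<bar>u y - average m (ball x r) u\<bar> \<partial>m) / emeasure m (ball x r)
        \<le> ennreal (C * r) / emeasure m (ball x (lam * r)) *
           (\<integral>\<^sup>+y\<in>ball x (lam * r). lip u y \<partial>m))"

definition PI_space_with :: "'a::polish_space measure \<Rightarrow> real \<Rightarrow> real \<Rightarrow> real \<Rightarrow> bool" where
  "PI_space_with m Cm C lam \<longleftrightarrow> metric_measure m \<and> doubling m Cm \<and> poincare m C lam"

text \<open>
  The restriction \<open>m|\<^sub>B\<close> is a measure on all of \<open>X\<close>, not on the subspace \<open>B\<close>: the total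
  variation in \<open>(X, d, m|\<^sub>B)\<close> uses functions that are locally Lipschitz on open subsets of \<open>X\<close>.
\<close>

definition mrestrict :: "'a measure \<Rightarrow> 'a set \<Rightarrow> 'a measure" where
  "mrestrict m B = density m (indicator B)"

text \<open>
  Local convergence in an open set \<open>A\<close>: every point of \<open>A\<close> has a neighbourhood in \<open>A\<close>,
  independent of \<open>n\<close>, on which the convergence is in \<open>L\<^sup>1\<close>.
\<close>

definition L1_loc_conv ::
    "'a::metric_space measure \<Rightarrow> 'a set \<Rightarrow> (nat \<Rightarrow> 'a \<Rightarrow> real) \<Rightarrow> ('a \<Rightarrow> real) \<Rightarrow> bool" where
  "L1_loc_conv \<mu> A un u \<longleftrightarrow>
     (\<forall>x\<in>A. \<exists>r>0. ball x r \<subseteq> A \<and>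
        (\<lambda>n. \<integral>\<^sup>+y\<in>ball x r. ennreal \<bar>un n y - u y\<bar> \<partial>\<mu>) \<longlonglongrightarrow> 0)"

definition tot_var_open :: "'a::metric_space measure \<Rightarrow> ('a \<Rightarrow> real) \<Rightarrow> 'a set \<Rightarrow> ennreal" where
  "tot_var_open \<mu> u A =
     Inf {liminf (\<lambda>n. \<integral>\<^sup>+x\<in>A. lip (un n) x \<partial>\<mu>) | un.
            (\<forall>n. loc_lipschitz_on A (un n)) \<and> L1_loc_conv \<mu> A un u}"

definition tot_var :: "'a::metric_space measure \<Rightarrow> ('a \<Rightarrow> real) \<Rightarrow> 'a set \<Rightarrow> ennreal" where
  "tot_var \<mu> u B = Inf {tot_var_open \<mu> u A | A. open A \<and> B \<subseteq> A}"

definition perimeter :: "'a::metric_space measure \<Rightarrow> 'a set \<Rightarrow> 'a set \<Rightarrow> 'a set \<Rightarrow> ennreal" where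
  "perimeter m B F G = tot_var (mrestrict m B) (indicator F) (B \<inter> G)"

definition BV :: "'a::metric_space measure \<Rightarrow> 'a set \<Rightarrow> ('a \<Rightarrow> real) set" where
  "BV m B = {u. integrable (mrestrict m B) u \<and> tot_var (mrestrict m B) u B < \<infinity>}"

definition BV_norm :: "'a::metric_space measure \<Rightarrow> 'a set \<Rightarrow> ('a \<Rightarrow> real) \<Rightarrow> ennreal" where
  "BV_norm m B u = (\<integral>\<^sup>+x. ennreal \<bar>u x\<bar> \<partial>mrestrict m B) + tot_var (mrestrict m B) u B"

text \<open>
  Elements of \<open>BV\<close> are classes modulo a.e. equality; the second conjunct on \<open>T\<close> says that
  \<open>T\<close>, given on representatives, is well defined on classes.
\<close>

definition BV_extension_with :: "'a::metric_space measure \<Rightarrow> 'a set \<Rightarrow> real \<Rightarrow> bool" where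
  "BV_extension_with m E C \<longleftrightarrow> E \<in> sets borel \<and> C \<ge> 1 \<and>
     (\<exists>T. (\<forall>u\<in>BV m E. T u \<in> BV m UNIV) \<and>
          (\<forall>u\<in>BV m E. \<forall>v\<in>BV m E.
             (AE x in mrestrict m E. u x = v x) \<longrightarrow> (AE x in m. T u x = T v x)) \<and>
          (\<forall>u\<in>BV m E. (AE x in mrestrict m E. T u x = u x) \<and>
             BV_norm m UNIV (T u) \<le> ennreal C * BV_norm m E u))"

end

theory Submission
  imports Defs
begin

text \<open>
  Every piece \<open>F\<close> of the partition has volume at least a fixed fraction of the volume of a ball
  \<open>B\<close> that contains \<open>E\<close>; as the pieces are disjoint subsets of \<open>B\<close>, this bounds their number.

  The volume bound holds because \<open>F\<close> has no perimeter in \<open>E\<close>: its indicator has \<open>BV(E)\<close> norm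
  \<open>m F\<close>, so it extends to a function \<open>v\<close> on \<open>X\<close> with \<open>\<integral>\<bar>v\<bar> + \<bar>Dv\<bar>(X) \<le> CE * m F\<close>
  (\<open>BV_extension_of_piece\<close>). On the other hand, a set of small volume on which a function equals
  \<open>1\<close> forces a total variation much larger than the volume of that set, unless the function has
  large \<open>L\<^sup>1\<close> norm (\<open>volume_lower_bound\<close>). A Sobolev inequality would express this, but one
  scale is enough. Cover \<open>F\<close> by balls of a small radius \<open>r\<close> with centres in a separated net. The
  Poincare inequality on these balls, together with the bounded overlap of their dilations, gives
  that the deviation of \<open>v\<close> from its averages over the balls has integral at most
  \<open>const * r * \<bar>Dv\<bar>(X)\<close> (\<open>poincare_net\<close>), hence at most \<open>const * r * m F\<close>. If \<open>m F\<close> is tiny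
  compared with \<open>m B\<close>, the averages themselves are small, because \<open>\<integral>\<bar>v\<bar> \<le> CE * m F\<close> while
  each of the balls has a definite fraction of the volume of \<open>B\<close>. So the deviation is about \<open>1\<close> on \<open>F\<close> and its integral is about
  \<open>m F\<close>. For \<open>r\<close> small, depending only on the constants, this is impossible.

  The Poincare inequality concerns locally Lipschitz functions only, and the estimates are carried
  out for one Lipschitz function close to \<open>v\<close>. Local convergence gives closeness
  on compact sets, and closed balls are compact since \<open>X\<close> is complete and doubling.
\<close>

section \<open>Doubling: volume comparison, packing and nets\<close>

lemma doubling_ball_finite:
  assumes "doubling m Cm" and "r > 0"
  shows "emeasure m (ball x r) < \<infinity>"
  using assms unfolding doubling_def
  by (metis ennreal_eq_0_iff ennreal_mult_eq_top_iff infinity_ennreal_def linorder_not_le top.not_eq_extremum)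

lemma doubling_ball_pos:
  assumes "doubling m Cm" and "r > 0"
  shows "measure m (ball x r) > 0"
proof -
  have "0 < emeasure m (ball x (2 * (r/2)))"
    using assms half_gt_zero[OF assms(2)] unfolding doubling_def by blast
  then show ?thesis
    using doubling_ball_finite[OF assms, of x] by (simp add: emeasure_eq_ennreal_measure top.not_eq_extremum)
qed

lemma emeasure_doubling_ball:
  assumes "doubling m Cm" and "r > 0"
  shows "emeasure m (ball x r) = ennreal (measure m (ball x r))"
  using doubling_ball_finite[OF assms] by (simp add: emeasure_eq_ennreal_measure top.not_eq_extremum)

lemma doubling_iterate:
  assumes dbl: "doubling m Cm" and "r > 0"
  shows "measure m (ball x (2 ^ k * r)) \<le> Cm ^ k * measure m (ball x r)"
proof (induction k)
  case (Suc k)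
  have Cm: "Cm > 0" using dbl by (simp add: doubling_def)
  have pos: "2 ^ k * r > 0" using \<open>r > 0\<close> by simp
  have "emeasure m (ball x (2 * (2 ^ k * r))) \<le> ennreal Cm * emeasure m (ball x (2 ^ k * r))"
    using dbl pos unfolding doubling_def by blast
  then have "measure m (ball x (2 * (2 ^ k * r))) \<le> Cm * measure m (ball x (2 ^ k * r))"
    using Cm pos emeasure_doubling_ball[OF dbl, of "2 * (2 ^ k * r)" x]
      emeasure_doubling_ball[OF dbl pos, of x]
    by (simp add: ennreal_mult[symmetric])
  also have "\<dots> \<le> Cm * (Cm ^ k * measure m (ball x r))"
    using Suc Cm by simp
  finally show ?case by (simp add: mult.assoc)
qed simp

lemma doubling_volume_comparison:
  assumes dbl: "doubling m Cm" and sets: "sets m = sets borel"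
    and "r > 0" and sub: "ball y R \<subseteq> ball x (2 ^ k * r)"
  shows "measure m (ball y R) \<le> Cm ^ k * measure m (ball x r)"
proof -
  have "measure m (ball y R) \<le> measure m (ball x (2 ^ k * r))"
    using sub doubling_ball_finite[OF dbl, of "2 ^ k * r" x] \<open>r > 0\<close>
    by (intro measure_mono_fmeasurable) (auto simp: fmeasurable_def sets)
  also have "\<dots> \<le> Cm ^ k * measure m (ball x r)"
    by (rule doubling_iterate[OF dbl \<open>r > 0\<close>])
  finally show ?thesis .
qed

definition separated :: "real \<Rightarrow> 'a::metric_space set \<Rightarrow> bool" where
  "separated r S \<longleftrightarrow> (\<forall>x\<in>S. \<forall>y\<in>S. x \<noteq> y \<longrightarrow> r \<le> dist x y)"

text \<open>
  The balls of radius \<open>r / 2\<close> around the points of \<open>S\<close> are disjoint, all lie in one ball around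
  \<open>y\<close>, and by doubling each has at least the fraction \<open>1 / Cm ^ k\<close> of the volume of that ball.
\<close>

lemma doubling_packing:
  fixes m :: "'a::metric_space measure" and S :: "'a set"
  assumes dbl: "doubling m Cm" and sets: "sets m = sets borel"
    and fin: "finite S" and sep: "separated r S" and "S \<subseteq> ball y \<rho>"
    and "r > 0" and k: "4 * \<rho> + r \<le> 2 ^ k * r"
  shows "real (card S) \<le> Cm ^ k"
proof (cases "S = {}")
  case False
  then have "\<rho> > 0" using \<open>S \<subseteq> ball y \<rho>\<close> zero_le_dist order.strict_trans1
    by (metis ball_empty leI subset_empty)
  let ?V = "measure m (ball y (\<rho> + r/2))"
  have Cm: "Cm > 0" using dbl by (simp add: doubling_def)
  have "?V > 0" using dbl \<open>\<rho> > 0\<close> \<open>r > 0\<close> by (intro doubling_ball_pos) auto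
  have fm: "ball z t \<in> fmeasurable m" for z t
    using doubling_ball_finite[OF dbl] by (cases "t > 0") (auto simp: fmeasurable_def sets ball_empty)
  have large: "?V \<le> Cm ^ k * measure m (ball x (r/2))" if "x \<in> S" for x
  proof (rule doubling_volume_comparison[OF dbl sets])
    show "ball y (\<rho> + r/2) \<subseteq> ball x (2 ^ k * (r/2))"
    proof
      fix z assume "z \<in> ball y (\<rho> + r/2)"
      moreover have "dist y x < \<rho>" using that \<open>S \<subseteq> ball y \<rho>\<close> by auto
      ultimately have "dist x z < 2 * \<rho> + r/2"
        using dist_triangle[of x z y] by (simp add: dist_commute)
      then show "z \<in> ball x (2 ^ k * (r/2))" using k by simp
    qed
  qed (use \<open>r > 0\<close> in simp)
  have "disjoint_family_on (\<lambda>x. ball x (r/2)) S"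
    unfolding disjoint_family_on_def
  proof (intro ballI impI, rule ccontr)
    fix a b assume ab: "a \<in> S" "b \<in> S" "a \<noteq> b" "ball a (r/2) \<inter> ball b (r/2) \<noteq> {}"
    then obtain z where "dist a z < r/2" "dist b z < r/2" by auto
    then have "dist a b < r" using dist_triangle[of a b z] by (simp add: dist_commute)
    then show False using sep ab by (force simp: separated_def)
  qed
  then have "(\<Sum>x\<in>S. measure m (ball x (r/2))) = measure m (\<Union>x\<in>S. ball x (r/2))"
    using fin fm by (intro measure_finite_Union[symmetric])
      (auto simp: fmeasurable_def less_top dest: fmeasurableD2)
  also have "\<dots> \<le> ?V"
  proof (intro measure_mono_fmeasurable fm)
    show "(\<Union>x\<in>S. ball x (r/2)) \<subseteq> ball y (\<rho> + r/2)"
    proof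
      fix z assume "z \<in> (\<Union>x\<in>S. ball x (r/2))"
      then obtain x where "x \<in> S" "dist x z < r/2" by auto
      moreover have "dist y x < \<rho>" using \<open>x \<in> S\<close> \<open>S \<subseteq> ball y \<rho>\<close> by auto
      ultimately show "z \<in> ball y (\<rho> + r/2)" using dist_triangle[of y z x] by simp
    qed
  qed (auto simp: sets intro!: borel_open)
  finally have sum: "(\<Sum>x\<in>S. measure m (ball x (r/2))) \<le> ?V" .
  have "real (card S) * ?V = (\<Sum>x\<in>S. ?V)" by simp
  also have "\<dots> \<le> (\<Sum>x\<in>S. Cm ^ k * measure m (ball x (r/2)))"
    by (intro sum_mono large)
  also have "\<dots> \<le> Cm ^ k * ?V"
    using sum Cm by (simp add: sum_distrib_left[symmetric])
  finally show ?thesis using \<open>?V > 0\<close> by simp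
qed (use dbl in \<open>simp add: doubling_def\<close>)

text \<open>
  Packing bounds the cardinality of an \<open>r\<close>-separated subset; one of maximal cardinality
  is an \<open>r\<close>-net, since a point missed by its balls could be added to it.
\<close>

lemma doubling_separated_net:
  fixes m :: "'a::metric_space measure" and A :: "'a::metric_space set"
  assumes dbl: "doubling m Cm" and sets: "sets m = sets borel"
    and "bounded A" and "r > 0"
  obtains S where "finite S" "S \<subseteq> A" "separated r S" "A \<subseteq> (\<Union>x\<in>S. ball x r)"
proof -
  obtain y :: 'a and \<rho> where A: "A \<subseteq> ball y \<rho>" using \<open>bounded A\<close>
    by (metis bounded_subset_ballD)
  obtain k :: nat where "(4 * \<rho> + r) / r < 2 ^ k" using real_arch_pow[of 2] by force
  then have k: "4 * \<rho> + r \<le> 2 ^ k * r" using \<open>r > 0\<close> by (simp add: field_simps)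
  let ?P = "\<lambda>S. finite S \<and> S \<subseteq> A \<and> separated r S"
  have bound: "card S < Suc (nat \<lceil>Cm ^ k\<rceil>)" if "?P S" for S
  proof -
    have "real (card S) \<le> Cm ^ k"
      using that A by (intro doubling_packing[OF dbl sets _ _ _ \<open>r > 0\<close> k]) auto
    then show ?thesis by linarith
  qed
  have "?P {}" by (simp add: separated_def)
  then obtain S where S: "?P S" and max: "\<And>S'. ?P S' \<Longrightarrow> card S' \<le> card S"
    using ex_has_greatest_nat[of ?P "{}" card] bound by (metis less_imp_le)
  have "A \<subseteq> (\<Union>x\<in>S. ball x r)"
  proof (rule subsetI, rule ccontr)
    fix z assume z: "z \<in> A" "z \<notin> (\<Union>x\<in>S. ball x r)"
    then have far: "r \<le> dist x z" if "x \<in> S" for x using that by auto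
    have "z \<notin> S" using z(2) \<open>r > 0\<close> by auto
    have "?P (insert z S)" using S z far by (auto simp: separated_def dist_commute)
    from max[OF this] show False using S \<open>z \<notin> S\<close> by simp
  qed
  with S that show ?thesis by blast
qed

lemma doubling_compact_cball:
  fixes m :: "'a::polish_space measure" and x :: 'a
  assumes "doubling m Cm" and "sets m = sets borel"
  shows "compact (cball x R)"
  unfolding compact_eq_totally_bounded
proof (intro conjI allI impI)
  show "complete (cball x R)" by (simp add: complete_eq_closed)
  fix e :: real assume "e > 0"
  from doubling_separated_net[OF assms bounded_cball this]
  show "\<exists>S. finite S \<and> cball x R \<subseteq> (\<Union>x\<in>S. ball x e)" by metis
qed

section \<open>The local Lipschitz constant and the Poincare inequality\<close>

lemma loc_lipschitz_on_continuous:
  assumes "loc_lipschitz_on UNIV u"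
  shows "continuous_on UNIV u"
proof (simp add: continuous_on_eq_continuous_at, intro allI)
  fix x
  obtain r L where "r > 0" "L-lipschitz_on (ball x r) u"
    using assms unfolding loc_lipschitz_on_def by (metis UNIV_I inf_top_right)
  then have "continuous_on (ball x r) u" by (intro lipschitz_on_continuous_on)
  then show "isCont u x" using \<open>r > 0\<close> by (simp add: continuous_on_eq_continuous_at)
qed

text \<open>
  At an isolated point \<open>at x\<close> is the trivial filter, whose \<open>Limsup\<close> is \<open>0\<close>, so the case
  distinction in \<open>lip\<close> disappears.
\<close>

lemma lip_eq_INF_SUP:
  "lip u x = (INF n::nat. SUP y\<in>ball x (1 / real (Suc n)) - {x}. ennreal (\<bar>u y - u x\<bar> / dist y x))"
proof -
  let ?f = "\<lambda>y. ennreal (\<bar>u y - u x\<bar> / dist y x)"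
  have "lip u x = Limsup (at x) ?f"
  proof (cases "x islimpt UNIV")
    case False
    then have "at x = bot" by (simp add: trivial_limit_within)
    then show ?thesis using False
      by (simp add: lip_def bot_ennreal)
  qed (simp add: lip_def)
  also have "\<dots> = (INF e\<in>{0<..}. SUP y\<in>ball x e - {x}. ?f y)"
    by (rule Limsup_at)
  also have "\<dots> = (INF n::nat. SUP y\<in>ball x (1 / real (Suc n)) - {x}. ?f y)"
  proof (rule INF_eq)
    fix e :: real assume "e \<in> {0<..}"
    then obtain n where n: "1 / real (Suc n) < e" using nat_approx_posE by auto
    then have "ball x (1 / real (Suc n)) - {x} \<subseteq> ball x e - {x}" by auto
    then show "\<exists>n\<in>UNIV. (SUP y\<in>ball x (1 / real (Suc n)) - {x}. ?f y) \<le> (SUP y\<in>ball x e - {x}. ?f y)"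
      by (intro bexI[of _ n] SUP_subset_mono) auto
  next
    fix n :: nat
    show "\<exists>e\<in>{0<..}. (SUP y\<in>ball x e - {x}. ?f y) \<le> (SUP y\<in>ball x (1 / real (Suc n)) - {x}. ?f y)"
      by (intro bexI[of _ "1 / real (Suc n)"]) auto
  qed
  finally show ?thesis .
qed

text \<open>
  At a fixed scale the supremum of the difference quotients is lower semicontinuous in the base
  point: if it exceeds \<open>a\<close> at \<open>x\<close>, the witness \<open>y\<close> works for all base points near \<open>x\<close>.
\<close>

lemma borel_measurable_lip:
  fixes u :: "'a::metric_space \<Rightarrow> real"
  assumes cont: "continuous_on UNIV u"
  shows "lip u \<in> borel_measurable borel"
proof -
  let ?q = "\<lambda>y x. ennreal (\<bar>u y - u x\<bar> / dist y x)"
  have "(\<lambda>x. SUP y\<in>ball x e - {x}. ?q y x) \<in> borel_measurable borel" for e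
  proof (rule borel_measurableI_greater)
    fix a
    have eq: "{x. a < (SUP y\<in>ball x e - {x}. ?q y x)} = (\<Union>y. {x \<in> ball y e - {y}. ?q y x \<in> {a<..}})"
      by (auto simp: less_SUP_iff dist_commute)
    have "open {x \<in> ball y e - {y}. ?q y x \<in> {a<..}}" for y
    proof -
      have "continuous_on (ball y e - {y}) (?q y)"
        by (intro continuous_on_ennreal continuous_intros continuous_on_subset[OF cont]) auto
      then have "open ((ball y e - {y}) \<inter> ?q y -` {a<..})"
        by (intro continuous_open_preimage) auto
      then show ?thesis by (simp add: vimage_def Int_def)
    qed
    then have "open {x. a < (SUP y\<in>ball x e - {x}. ?q y x)}"
      unfolding eq by blast
    then show "{x \<in> space borel. a < (SUP y\<in>ball x e - {x}. ?q y x)} \<in> sets borel" by simp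
  qed
  then have "(\<lambda>x. INF n::nat. SUP y\<in>ball x (1 / real (Suc n)) - {x}. ?q y x) \<in> borel_measurable borel"
    by (intro borel_measurable_INF) auto
  then show ?thesis by (simp add: lip_eq_INF_SUP[abs_def])
qed

lemma poincare_ball:
  assumes dbl: "doubling m Cm" and sets: "sets m = sets borel"
    and P: "poincare m CP lam" and u: "loc_lipschitz_on UNIV u" and "r > 0"
  shows "(\<integral>\<^sup>+y\<in>ball x r. ennreal \<bar>u y - average m (ball x r) u\<bar> \<partial>m)
    \<le> ennreal (CP * r) * (\<integral>\<^sup>+y\<in>ball x (lam * r). lip u y \<partial>m)"
proof -
  let ?B = "ball x r" and ?B' = "ball x (lam * r)"
  let ?I = "\<integral>\<^sup>+y\<in>?B. ennreal \<bar>u y - average m ?B u\<bar> \<partial>m"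
  let ?J = "\<integral>\<^sup>+y\<in>?B'. lip u y \<partial>m"
  have "lam \<ge> 1" "CP > 0" using P by (auto simp: poincare_def)
  then have pos': "lam * r > 0" using \<open>r > 0\<close> by simp
  let ?b = "measure m ?B" and ?b' = "measure m ?B'"
  have b: "?b > 0" "?b' > 0" using doubling_ball_pos[OF dbl] \<open>r > 0\<close> pos' by auto
  have "r \<le> lam * r" using \<open>lam \<ge> 1\<close> \<open>r > 0\<close> by simp
  then have "?b \<le> ?b'"
    using doubling_ball_finite[OF dbl pos', of x]
    by (intro measure_mono_fmeasurable) (auto simp: fmeasurable_def sets)
  have "?I / ennreal ?b \<le> ennreal (CP * r) / ennreal ?b' * ?J"
    using P u \<open>r > 0\<close> unfolding poincare_def
      emeasure_doubling_ball[OF dbl \<open>r > 0\<close>, symmetric] emeasure_doubling_ball[OF dbl pos', symmetric]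
    by blast
  then have "?I / ennreal ?b * ennreal ?b \<le> ennreal (CP * r) / ennreal ?b' * ?J * ennreal ?b"
    by (intro mult_right_mono) auto
  also have "?I / ennreal ?b * ennreal ?b = ?I"
    using b by (subst ennreal_divide_times) simp
  also have "ennreal (CP * r) / ennreal ?b' * ?J * ennreal ?b = ennreal (CP * r * (?b / ?b')) * ?J"
  proof -
    have "ennreal (CP * r) / ennreal ?b' * ennreal ?b = ennreal (CP * r * (?b / ?b'))"
      using b \<open>CP > 0\<close> \<open>r > 0\<close> by (simp add: divide_ennreal ennreal_mult[symmetric])
    from this[symmetric] show ?thesis by (simp only: ac_simps)
  qed
  also have "\<dots> \<le> ennreal (CP * r) * ?J"
  proof (intro mult_right_mono ennreal_leI)
    have "?b / ?b' \<le> 1" using \<open>?b \<le> ?b'\<close> b by simp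
    then show "CP * r * (?b / ?b') \<le> CP * r"
      using \<open>CP > 0\<close> \<open>r > 0\<close> mult_left_mono[of "?b / ?b'" 1 "CP * r"] by simp
  qed simp
  finally show ?thesis .
qed

text \<open>
  The Poincare inequalities on the balls of a net add up: by packing a point lies in
  at most \<open>Cm ^ p\<close> of the dilated balls, for an exponent \<open>p\<close> that depends on \<open>lam\<close> but not on \<open>r\<close>.
  The factor \<open>r\<close> on the right is the gain at small scales.
\<close>

lemma poincare_net:
  assumes dbl: "doubling m Cm" and sets: "sets m = sets borel"
    and P: "poincare m CP lam" and u: "loc_lipschitz_on UNIV u" and "r > 0"
    and fin: "finite S" and sep: "separated r S" and p: "4 * lam + 1 \<le> 2 ^ p"
  shows "(\<Sum>x\<in>S. \<integral>\<^sup>+y\<in>ball x r. ennreal \<bar>u y - average m (ball x r) u\<bar> \<partial>m)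
    \<le> ennreal (CP * r * Cm ^ p) * (\<integral>\<^sup>+y. lip u y \<partial>m)"
proof -
  have pos: "CP > 0" "Cm > 0" using P dbl by (auto simp: poincare_def doubling_def)
  have [measurable]: "lip u \<in> borel_measurable m"
    using borel_measurable_lip[OF loc_lipschitz_on_continuous[OF u]] measurable_cong_sets[OF sets refl] by blast
  have [measurable]: "ball x t \<in> sets m" for x t by (simp add: sets)
  have overlap: "(\<Sum>x\<in>S. indicator (ball x (lam * r)) y) \<le> ennreal (Cm ^ p)" for y
  proof -
    let ?S = "{x\<in>S. y \<in> ball x (lam * r)}"
    have "(\<Sum>x\<in>S. indicator (ball x (lam * r)) y) = (of_nat (card ?S) :: ennreal)"
      using fin by (simp add: indicator_def sum.If_cases Int_def del: mem_ball)
    also have "\<dots> = ennreal (real (card ?S))" by (simp add: ennreal_of_nat_eq_real_of_nat)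
    also have "\<dots> \<le> ennreal (Cm ^ p)"
    proof (intro ennreal_leI doubling_packing[OF dbl sets _ _ _ \<open>r > 0\<close>])
      show "?S \<subseteq> ball y (lam * r)" by (auto simp: dist_commute)
      show "4 * (lam * r) + r \<le> 2 ^ p * r"
        using mult_right_mono[OF p, of r] \<open>r > 0\<close> by (simp add: algebra_simps)
    qed (use fin sep in \<open>auto simp: separated_def\<close>)
    finally show ?thesis .
  qed
  have "(\<Sum>x\<in>S. \<integral>\<^sup>+y\<in>ball x r. ennreal \<bar>u y - average m (ball x r) u\<bar> \<partial>m)
      \<le> (\<Sum>x\<in>S. ennreal (CP * r) * (\<integral>\<^sup>+y\<in>ball x (lam * r). lip u y \<partial>m))"
    by (intro sum_mono poincare_ball[OF dbl sets P u \<open>r > 0\<close>])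
  also have "\<dots> = ennreal (CP * r) * (\<integral>\<^sup>+y. (\<Sum>x\<in>S. lip u y * indicator (ball x (lam * r)) y) \<partial>m)"
    by (subst nn_integral_sum) (auto simp: sum_distrib_left)
  also have "\<dots> \<le> ennreal (CP * r) * (\<integral>\<^sup>+y. ennreal (Cm ^ p) * lip u y \<partial>m)"
  proof (intro mult_left_mono nn_integral_mono)
    fix y
    have "(\<Sum>x\<in>S. lip u y * indicator (ball x (lam * r)) y)
        = lip u y * (\<Sum>x\<in>S. indicator (ball x (lam * r)) y)" by (simp add: sum_distrib_left)
    also have "\<dots> \<le> lip u y * ennreal (Cm ^ p)" by (intro mult_left_mono overlap) simp
    finally show "(\<Sum>x\<in>S. lip u y * indicator (ball x (lam * r)) y) \<le> ennreal (Cm ^ p) * lip u y"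
      by (simp add: mult.commute)
  qed simp
  also have "\<dots> = ennreal (CP * r * Cm ^ p) * (\<integral>\<^sup>+y. lip u y \<partial>m)"
    using pos \<open>r > 0\<close> by (simp add: nn_integral_cmult ennreal_mult mult.assoc)
  finally show ?thesis .
qed

section \<open>Functions of bounded variation and their Lipschitz approximations\<close>

text \<open>
  The neighbourhoods of local convergence do not depend on \<open>n\<close>, so finitely many of them cover
  \<open>K\<close> for all \<open>n\<close> at once.
\<close>

lemma L1_loc_conv_compact:
  fixes m :: "'a::metric_space measure"
  assumes sets: "sets m = sets borel" and K: "compact K"
    and un: "\<And>n. un n \<in> borel_measurable m" and v: "v \<in> borel_measurable m"
    and conv: "L1_loc_conv m UNIV un v"
  shows "(\<lambda>n. \<integral>\<^sup>+y\<in>K. ennreal \<bar>un n y - v y\<bar> \<partial>m) \<longlonglongrightarrow> 0"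
proof -
  note [measurable] = un v
  have [measurable]: "ball x t \<in> sets m" for x t by (simp add: sets)
  have "\<forall>x. \<exists>r. r > 0 \<and> (\<lambda>n. \<integral>\<^sup>+y\<in>ball x r. ennreal \<bar>un n y - v y\<bar> \<partial>m) \<longlonglongrightarrow> 0"
    using conv unfolding L1_loc_conv_def by blast
  from choice[OF this] obtain \<rho> where \<rho>: "\<And>x. \<rho> x > 0"
    "\<And>x. (\<lambda>n. \<integral>\<^sup>+y\<in>ball x (\<rho> x). ennreal \<bar>un n y - v y\<bar> \<partial>m) \<longlonglongrightarrow> 0"
    by blast
  have "K \<subseteq> (\<Union>x\<in>K. ball x (\<rho> x))" using \<rho>(1) by auto
  then obtain D where D: "D \<subseteq> K" "finite D" "K \<subseteq> (\<Union>x\<in>D. ball x (\<rho> x))"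
    using compactE_image[OF K, of K "\<lambda>x. ball x (\<rho> x)"] by blast
  have "(\<lambda>n. \<Sum>x\<in>D. \<integral>\<^sup>+y\<in>ball x (\<rho> x). ennreal \<bar>un n y - v y\<bar> \<partial>m) \<longlonglongrightarrow> (\<Sum>x\<in>D. 0)"
    by (intro tendsto_sum \<rho>)
  then have lim: "(\<lambda>n. \<Sum>x\<in>D. \<integral>\<^sup>+y\<in>ball x (\<rho> x). ennreal \<bar>un n y - v y\<bar> \<partial>m) \<longlonglongrightarrow> 0" by simp
  have "(\<integral>\<^sup>+y\<in>K. ennreal \<bar>un n y - v y\<bar> \<partial>m)
      \<le> (\<Sum>x\<in>D. \<integral>\<^sup>+y\<in>ball x (\<rho> x). ennreal \<bar>un n y - v y\<bar> \<partial>m)" for n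
  proof -
    have "(\<integral>\<^sup>+y\<in>K. ennreal \<bar>un n y - v y\<bar> \<partial>m)
        \<le> (\<integral>\<^sup>+y. (\<Sum>x\<in>D. ennreal \<bar>un n y - v y\<bar> * indicator (ball x (\<rho> x)) y) \<partial>m)"
    proof (intro nn_integral_mono)
      fix y
      show "ennreal \<bar>un n y - v y\<bar> * indicator K y
          \<le> (\<Sum>x\<in>D. ennreal \<bar>un n y - v y\<bar> * indicator (ball x (\<rho> x)) y)"
      proof (cases "y \<in> K")
        case True
        then obtain z where z: "z \<in> D" "y \<in> ball z (\<rho> z)" using D by auto
        then have "ennreal \<bar>un n y - v y\<bar> * indicator K y
            = ennreal \<bar>un n y - v y\<bar> * indicator (ball z (\<rho> z)) y" using True by simp
        also have "\<dots> \<le> (\<Sum>x\<in>D. ennreal \<bar>un n y - v y\<bar> * indicator (ball x (\<rho> x)) y)"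
          using z D(2) by (intro member_le_sum) auto
        finally show ?thesis .
      qed simp
    qed
    also have "\<dots> = (\<Sum>x\<in>D. \<integral>\<^sup>+y\<in>ball x (\<rho> x). ennreal \<bar>un n y - v y\<bar> \<partial>m)"
      by (rule nn_integral_sum) measurable
    finally show ?thesis .
  qed
  then show ?thesis
    by (intro tendsto_sandwich[OF _ _ tendsto_const lim]) simp_all
qed

text \<open>
  Of an approximating sequence only one member is kept: the \<open>liminf\<close> bounds the energy for infinitely
  many \<open>n\<close>, and the \<open>L\<^sup>1\<close> distance on \<open>K\<close> is small for all large ones.
\<close>

lemma tot_var_lipschitz_approx:
  fixes m :: "'a::metric_space measure"
  assumes sets: "sets m = sets borel" and K: "compact K"
    and v: "v \<in> borel_measurable m" and tv: "tot_var m v UNIV < b" and "\<epsilon> > 0"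
  obtains u where "loc_lipschitz_on UNIV u" "(\<integral>\<^sup>+y. lip u y \<partial>m) < b"
    "(\<integral>\<^sup>+y\<in>K. ennreal \<bar>u y - v y\<bar> \<partial>m) < \<epsilon>"
proof -
  have "tot_var_open m v UNIV < b"
    using tv unfolding tot_var_def by (auto simp: Inf_less_iff dest: top.extremum_uniqueI)
  then obtain un where un: "\<And>n. loc_lipschitz_on UNIV (un n)" "L1_loc_conv m UNIV un v"
    "liminf (\<lambda>n. \<integral>\<^sup>+y. lip (un n) y \<partial>m) < b"
    unfolding tot_var_open_def by (auto simp: Inf_less_iff)
  have meas: "un n \<in> borel_measurable m" for n
    using borel_measurable_continuous_onI[OF loc_lipschitz_on_continuous[OF un(1)]]
      measurable_cong_sets[OF sets refl] by blast
  have "eventually (\<lambda>n. (\<integral>\<^sup>+y\<in>K. ennreal \<bar>un n y - v y\<bar> \<partial>m) < \<epsilon>) sequentially"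
    using L1_loc_conv_compact[OF sets K meas v un(2)] \<open>\<epsilon> > 0\<close> by (rule order_tendstoD)
  moreover have "\<not> eventually (\<lambda>n. b \<le> (\<integral>\<^sup>+y. lip (un n) y \<partial>m)) sequentially"
    using un(3) Liminf_bounded by (metis leD)
  ultimately have "\<exists>n. (\<integral>\<^sup>+y\<in>K. ennreal \<bar>un n y - v y\<bar> \<partial>m) < \<epsilon> \<and> \<not> b \<le> (\<integral>\<^sup>+y. lip (un n) y \<partial>m)"
    by (metis (mono_tags, lifting) eventually_mono)
  then obtain n where "(\<integral>\<^sup>+y\<in>K. ennreal \<bar>un n y - v y\<bar> \<partial>m) < \<epsilon>" "(\<integral>\<^sup>+y. lip (un n) y \<partial>m) < b"
    by (auto simp: not_le)
  with un(1) that show ?thesis by blast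
qed

lemma abs_average_le:
  assumes [measurable]: "A \<in> sets m" "u \<in> borel_measurable m"
    and "measure m A > 0" and "b \<ge> 0" and b: "(\<integral>\<^sup>+y\<in>A. ennreal \<bar>u y\<bar> \<partial>m) \<le> ennreal b"
  shows "\<bar>average m A u\<bar> \<le> b / measure m A"
proof -
  let ?g = "\<lambda>y. indicator A y *\<^sub>R u y"
  have eq: "(\<integral>\<^sup>+y. ennreal (norm (?g y)) \<partial>m) = (\<integral>\<^sup>+y\<in>A. ennreal \<bar>u y\<bar> \<partial>m)"
    by (intro nn_integral_cong) (auto simp: indicator_def)
  have "integrable m ?g"
    unfolding integrable_iff_bounded eq using b by (auto intro: le_less_trans)
  then have "ennreal (norm (LINT y|m. ?g y)) \<le> ennreal b"
    using integral_norm_bound_ennreal[of m ?g] b unfolding eq by (meson order_trans)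
  then have "\<bar>LINT y:A|m. u y\<bar> \<le> b" using \<open>b \<ge> 0\<close> by (simp add: set_lebesgue_integral_def)
  then show ?thesis using \<open>measure m A > 0\<close> by (simp add: average_def divide_right_mono)
qed

section \<open>A lower volume bound\<close>

text \<open>
  Take a Lipschitz approximation \<open>u\<close> of \<open>v\<close> and an \<open>r\<close>-net of \<open>F\<close>. On \<open>F\<close> the
  function \<open>u\<close> is close to \<open>1\<close> in \<open>L\<^sup>1\<close>. If \<open>F\<close> were small compared with \<open>ball x0 R\<close>, then all
  averages of \<open>u\<close> over the net balls would be at most \<open>1/4\<close>, because \<open>u\<close> has \<open>L\<^sup>1\<close> norm
  comparable to \<open>m F\<close>. So \<open>u\<close> would deviate from its averages by about \<open>3/4\<close> on most of \<open>F\<close>,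
  whereas the Poincare inequality bounds the total deviation by a multiple of \<open>r * m F\<close>;
  for the given small \<open>r\<close> this is a contradiction.
\<close>

lemma volume_lower_bound:
  fixes m :: "'a::polish_space measure" and x0 :: 'a
  assumes dbl: "doubling m Cm" and sets: "sets m = sets borel" and P: "poincare m CP lam"
    and F: "F \<in> sets borel" "F \<subseteq> ball x0 R" "emeasure m F > 0"
    and v: "v \<in> borel_measurable m" and v1: "AE y in m. y \<in> F \<longrightarrow> v y = 1"
    and v_L1: "(\<integral>\<^sup>+y. ennreal \<bar>v y\<bar> \<partial>m) \<le> ennreal CE * emeasure m F"
    and v_tv: "tot_var m v UNIV \<le> ennreal CE * emeasure m F"
    and "CE \<ge> 1" and "R > 0" and "r > 0" and p: "4 * lam + 1 \<le> 2 ^ p"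
    and r: "16 * (CP * r * Cm ^ p) * CE \<le> 1" and k: "2 * R \<le> 2 ^ k * r"
  shows "measure m (ball x0 R) \<le> 8 * CE * Cm ^ k * measure m F"
proof (rule ccontr)
  let ?V = "measure m (ball x0 R)" and ?a = "measure m F" and ?K = "cball x0 (R + r)"
  assume "\<not> ?V \<le> 8 * CE * Cm ^ k * ?a"
  then have small: "8 * CE * Cm ^ k * ?a < ?V" by simp
  have Cm: "Cm > 0" using dbl by (simp add: doubling_def)
  have CP: "CP > 0" using P by (simp add: poincare_def)
  have [measurable]: "F \<in> sets m" "?K \<in> sets m" "ball x t \<in> sets m" for x t
    using F by (auto simp: sets)
  note [measurable] = v
  have "emeasure m F \<le> emeasure m (ball x0 R)" using F by (intro emeasure_mono) auto
  also have "\<dots> < \<infinity>" by (rule doubling_ball_finite[OF dbl \<open>R > 0\<close>])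
  finally have em: "emeasure m F = ennreal ?a" by (simp add: emeasure_eq_ennreal_measure top.not_eq_extremum)
  then have "?a > 0" using F(3) by simp
  have CEa: "ennreal CE * emeasure m F = ennreal (CE * ?a)" using \<open>CE \<ge> 1\<close> by (simp add: em ennreal_mult)

  have "bounded F" using F(2) bounded_subset bounded_ball by blast
  from doubling_separated_net[OF dbl sets this \<open>r > 0\<close>]
  obtain S where S: "finite S" "S \<subseteq> F" "separated r S" "F \<subseteq> (\<Union>x\<in>S. ball x r)" .
  have "tot_var m v UNIV < ennreal (2 * CE * ?a)"
    using v_tv unfolding CEa
    by (rule le_less_trans) (use \<open>?a > 0\<close> \<open>CE \<ge> 1\<close> in \<open>simp add: ennreal_less_iff\<close>)
  from tot_var_lipschitz_approx[OF sets doubling_compact_cball[OF dbl sets] v this, of "ennreal (?a / 8)" x0 "R + r"]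
  obtain u where u: "loc_lipschitz_on UNIV u" "(\<integral>\<^sup>+y. lip u y \<partial>m) < ennreal (2 * CE * ?a)"
    and uv: "(\<integral>\<^sup>+y\<in>?K. ennreal \<bar>u y - v y\<bar> \<partial>m) < ennreal (?a / 8)"
    using \<open>?a > 0\<close> by auto
  have [measurable]: "u \<in> borel_measurable m"
    using borel_measurable_continuous_onI[OF loc_lipschitz_on_continuous[OF u(1)]]
      measurable_cong_sets[OF sets refl] by blast

  have "(\<integral>\<^sup>+y\<in>?K. ennreal \<bar>u y\<bar> \<partial>m) \<le> (\<integral>\<^sup>+y. ennreal \<bar>v y\<bar> + ennreal \<bar>u y - v y\<bar> * indicator ?K y \<partial>m)"
    by (intro nn_integral_mono)
      (auto simp: ennreal_plus[symmetric] indicator_def simp del: ennreal_plus intro!: ennreal_leI)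
  also have "\<dots> = (\<integral>\<^sup>+y. ennreal \<bar>v y\<bar> \<partial>m) + (\<integral>\<^sup>+y\<in>?K. ennreal \<bar>u y - v y\<bar> \<partial>m)"
    by (intro nn_integral_add) auto
  also have "\<dots> \<le> ennreal (CE * ?a) + ennreal (?a / 8)"
    using v_L1 uv unfolding CEa by (intro add_mono) auto
  also have "\<dots> = ennreal (CE * ?a + ?a / 8)"
    using \<open>?a > 0\<close> \<open>CE \<ge> 1\<close> by (intro ennreal_plus[symmetric]) auto
  also have "\<dots> \<le> ennreal (2 * CE * ?a)"
  proof (intro ennreal_leI)
    have "1 * ?a \<le> CE * ?a" using \<open>?a > 0\<close> \<open>CE \<ge> 1\<close> by (intro mult_right_mono) auto
    then show "CE * ?a + ?a / 8 \<le> 2 * CE * ?a" using \<open>?a > 0\<close> by linarith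
  qed
  finally have u_L1: "(\<integral>\<^sup>+y\<in>?K. ennreal \<bar>u y\<bar> \<partial>m) \<le> ennreal (2 * CE * ?a)" .

  have avg: "\<bar>average m (ball x r) u\<bar> \<le> 1 / 4" if "x \<in> S" for x
  proof -
    have x: "dist x0 x < R" using that S(2) F(2) by auto
    have pos: "measure m (ball x r) > 0" by (rule doubling_ball_pos[OF dbl \<open>r > 0\<close>])
    have "ball x r \<subseteq> ?K"
    proof
      fix y assume "y \<in> ball x r"
      then show "y \<in> ?K" using x dist_triangle[of x0 y x] by simp
    qed
    then have "(\<integral>\<^sup>+y\<in>ball x r. ennreal \<bar>u y\<bar> \<partial>m) \<le> (\<integral>\<^sup>+y\<in>?K. ennreal \<bar>u y\<bar> \<partial>m)"
      by (intro nn_integral_mono) (auto simp: indicator_def)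
    with u_L1 have "(\<integral>\<^sup>+y\<in>ball x r. ennreal \<bar>u y\<bar> \<partial>m) \<le> ennreal (2 * CE * ?a)" by (rule order_trans[rotated])
    then have "\<bar>average m (ball x r) u\<bar> \<le> (2 * CE * ?a) / measure m (ball x r)"
      using pos \<open>?a > 0\<close> \<open>CE \<ge> 1\<close> by (intro abs_average_le) auto
    also have "\<dots> \<le> 1 / 4"
    proof -
      have "?V \<le> Cm ^ k * measure m (ball x r)"
      proof (rule doubling_volume_comparison[OF dbl sets \<open>r > 0\<close>])
        show "ball x0 R \<subseteq> ball x (2 ^ k * r)"
        proof
          fix z assume "z \<in> ball x0 R"
          then show "z \<in> ball x (2 ^ k * r)"
            using x k dist_triangle[of x z x0] by (simp add: dist_commute)
        qed
      qed
      with small have "Cm ^ k * (8 * CE * ?a) < Cm ^ k * measure m (ball x r)"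
        by (simp add: algebra_simps)
      then have "8 * CE * ?a < measure m (ball x r)" using Cm by simp
      then show ?thesis using pos by (simp add: field_simps)
    qed
    finally show ?thesis .
  qed

  let ?dev = "\<lambda>x y. ennreal \<bar>u y - average m (ball x r) u\<bar> * indicator (ball x r) y"
  have "AE y in m. ennreal (3/4) * indicator F y
      \<le> ennreal \<bar>u y - v y\<bar> * indicator ?K y + (\<Sum>x\<in>S. ?dev x y)"
    using v1
  proof eventually_elim
    case (elim y)
    show ?case
    proof (cases "y \<in> F")
      case True
      then obtain x where x: "x \<in> S" "y \<in> ball x r" using S(4) by auto
      have "y \<in> ?K" using True F(2) \<open>r > 0\<close> by force
      have "3/4 \<le> \<bar>u y - v y\<bar> + \<bar>u y - average m (ball x r) u\<bar>"
        using avg[OF x(1)] elim True by linarith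
      then have "ennreal (3/4) \<le> ennreal \<bar>u y - v y\<bar> + ?dev x y"
        using x(2) by (simp add: ennreal_plus[symmetric] ennreal_leI del: ennreal_plus)
      also have "?dev x y \<le> (\<Sum>x\<in>S. ?dev x y)" using x(1) S(1) by (intro member_le_sum) auto
      finally show ?thesis using True \<open>y \<in> ?K\<close> by (simp add: add_left_mono)
    qed simp
  qed
  then have "(\<integral>\<^sup>+y. ennreal (3/4) * indicator F y \<partial>m)
      \<le> (\<integral>\<^sup>+y. ennreal \<bar>u y - v y\<bar> * indicator ?K y + (\<Sum>x\<in>S. ?dev x y) \<partial>m)"
    by (rule nn_integral_mono_AE)
  also have "\<dots> = (\<integral>\<^sup>+y\<in>?K. ennreal \<bar>u y - v y\<bar> \<partial>m) + (\<Sum>x\<in>S. \<integral>\<^sup>+y. ?dev x y \<partial>m)"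
    by (simp add: nn_integral_add nn_integral_sum)
  also have "\<dots> \<le> ennreal (?a / 8) + ennreal (CP * r * Cm ^ p) * ennreal (2 * CE * ?a)"
  proof (intro add_mono less_imp_le[OF uv])
    show "(\<Sum>x\<in>S. \<integral>\<^sup>+y. ?dev x y \<partial>m) \<le> ennreal (CP * r * Cm ^ p) * ennreal (2 * CE * ?a)"
      using poincare_net[OF dbl sets P u(1) \<open>r > 0\<close> S(1,3) p]
      by (rule order_trans) (intro mult_left_mono less_imp_le[OF u(2)], simp)
  qed
  also have "\<dots> = ennreal (?a / 8 + CP * r * Cm ^ p * (2 * CE * ?a))"
    using \<open>?a > 0\<close> \<open>CE \<ge> 1\<close> CP Cm \<open>r > 0\<close> by (simp add: ennreal_mult[symmetric] ennreal_plus[symmetric] del: ennreal_plus)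
  also have "\<dots> \<le> ennreal (?a / 4)"
  proof (intro ennreal_leI)
    have "16 * (CP * r * Cm ^ p) * CE * ?a \<le> 1 * ?a"
      using r \<open>?a > 0\<close> by (intro mult_right_mono) auto
    then show "?a / 8 + CP * r * Cm ^ p * (2 * CE * ?a) \<le> ?a / 4" by (simp add: algebra_simps)
  qed
  also have "(\<integral>\<^sup>+y. ennreal (3/4) * indicator F y \<partial>m) = ennreal (3/4 * ?a)"
    by (simp add: nn_integral_cmult_indicator em ennreal_mult[symmetric])
  finally show False using \<open>?a > 0\<close> by (simp add: ennreal_le_iff)
qed

section \<open>Pieces without inner boundary\<close>

lemma mrestrict_UNIV [simp]: "mrestrict m UNIV = m"
  by (simp add: mrestrict_def density_1)

text \<open>
  A piece \<open>F\<close> with vanishing perimeter in \<open>E\<close> has an indicator of \<open>BV\<close> norm just \<open>m F\<close>, so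
  the extension is a function on \<open>X\<close> which equals \<open>1\<close> on \<open>F\<close> and whose \<open>BV\<close> norm is at most
  \<open>CE * m F\<close>.
\<close>

lemma BV_extension_of_piece:
  fixes m :: "'a::polish_space measure"
  assumes sets: "sets m = sets borel" and ext: "BV_extension_with m E CE"
    and F: "F \<in> sets borel" "F \<subseteq> E" "emeasure m F < \<infinity>" and per: "perimeter m E F E = 0"
  obtains v where "v \<in> borel_measurable m" "AE y in m. y \<in> F \<longrightarrow> v y = 1"
    "(\<integral>\<^sup>+y. ennreal \<bar>v y\<bar> \<partial>m) \<le> ennreal CE * emeasure m F"
    "tot_var m v UNIV \<le> ennreal CE * emeasure m F"
proof -
  let ?\<chi> = "indicator F :: 'a \<Rightarrow> real"
  have [measurable]: "E \<in> sets m" "F \<in> sets m"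
    using ext F by (auto simp: sets BV_extension_with_def)
  obtain T where T: "\<And>u. u \<in> BV m E \<Longrightarrow> T u \<in> BV m UNIV"
    "\<And>u. u \<in> BV m E \<Longrightarrow> AE x in mrestrict m E. T u x = u x"
    "\<And>u. u \<in> BV m E \<Longrightarrow> BV_norm m UNIV (T u) \<le> ennreal CE * BV_norm m E u"
    using ext unfolding BV_extension_with_def by blast
  have L1: "(\<integral>\<^sup>+x. ennreal \<bar>?\<chi> x\<bar> \<partial>mrestrict m E) = emeasure m F"
  proof -
    have "(\<integral>\<^sup>+x. ennreal \<bar>?\<chi> x\<bar> \<partial>mrestrict m E) = (\<integral>\<^sup>+x. indicator E x * ennreal \<bar>?\<chi> x\<bar> \<partial>m)"
      unfolding mrestrict_def by (rule nn_integral_density) auto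
    also have "\<dots> = (\<integral>\<^sup>+x. indicator F x \<partial>m)"
      using F(2) by (intro nn_integral_cong) (auto simp: indicator_def)
    finally show ?thesis by simp
  qed
  have tv: "tot_var (mrestrict m E) ?\<chi> E = 0" using per by (simp add: perimeter_def)
  have "integrable (mrestrict m E) ?\<chi>"
    unfolding integrable_iff_bounded using L1 F(3) by (simp add: mrestrict_def)
  then have BV: "?\<chi> \<in> BV m E" using tv by (simp add: BV_def)
  let ?v = "T ?\<chi>"
  have norm: "(\<integral>\<^sup>+y. ennreal \<bar>?v y\<bar> \<partial>m) + tot_var m ?v UNIV \<le> ennreal CE * emeasure m F"
    using T(3)[OF BV] unfolding BV_norm_def mrestrict_UNIV L1 tv by simp
  show ?thesis
  proof
    show "?v \<in> borel_measurable m"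
      using T(1)[OF BV] by (simp add: BV_def borel_measurable_integrable)
    have "AE x in m. 0 < (indicator E x :: ennreal) \<longrightarrow> ?v x = ?\<chi> x"
      using T(2)[OF BV] unfolding mrestrict_def by (subst (asm) AE_density) auto
    then show "AE y in m. y \<in> F \<longrightarrow> ?v y = 1"
      by eventually_elim (use F(2) in auto)
    show "(\<integral>\<^sup>+y. ennreal \<bar>?v y\<bar> \<partial>m) \<le> ennreal CE * emeasure m F"
      using norm by (rule order_trans[rotated]) simp
    show "tot_var m ?v UNIV \<le> ennreal CE * emeasure m F"
      using norm by (rule order_trans[rotated]) simp
  qed
qed

theorem lemma4p14:
  fixes E :: "'a::polish_space set" and Cm CP lam CE :: real
  assumes "closed E" and "bounded E"
  shows "\<exists>N::nat. \<forall>m::'a measure.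
    PI_space_with m Cm CP lam \<and> BV_extension_with m E CE \<longrightarrow>
    (\<forall>(M::nat) (Ei::nat \<Rightarrow> 'a set).
       (\<forall>i\<in>{1..M}. Ei i \<in> sets borel) \<and> disjoint_family_on Ei {1..M} \<and>
       (\<Union>i\<in>{1..M}. Ei i) = E \<and>
       (\<forall>i\<in>{1..M}. emeasure m (Ei i) > 0 \<and> perimeter m E (Ei i) E = 0)
       \<longrightarrow> M \<le> N)"
proof -
  obtain x0 :: 'a and R0 where "E \<subseteq> ball x0 R0"
    using \<open>bounded E\<close> by (metis bounded_subset_ballD)
  define R where "R = max R0 1"
  have R: "E \<subseteq> ball x0 R" "R > 0" using \<open>E \<subseteq> ball x0 R0\<close> by (auto simp: R_def)
  \<comment> \<open>None of the following choices may involve the measure, as the bound has to be uniform in it.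
    The radius \<open>r\<close> solves the smallness condition of the volume bound with equality.\<close>
  obtain p :: nat where p: "4 * lam + 1 < 2 ^ p" using real_arch_pow[of 2] by force
  define r where "r = 1 / (16 * CP * Cm ^ p * CE)"
  obtain k :: nat where k: "2 * R / r < 2 ^ k" using real_arch_pow[of 2] by force
  define Q where "Q = 8 * CE * Cm ^ k"
  have bound: "M \<le> nat \<lfloor>Q\<rfloor>"
    if PI: "PI_space_with m Cm CP lam" and ext: "BV_extension_with m E CE"
      and borel: "\<And>i. i \<in> {1..M} \<Longrightarrow> Ei i \<in> sets borel" and disj: "disjoint_family_on Ei {1..M}"
      and cover: "(\<Union>i\<in>{1..M}. Ei i) = E"
      and pos: "\<And>i. i \<in> {1..M} \<Longrightarrow> emeasure m (Ei i) > 0"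
      and per: "\<And>i. i \<in> {1..M} \<Longrightarrow> perimeter m E (Ei i) E = 0"
    for m :: "'a measure" and M :: nat and Ei
  proof -
    have dbl: "doubling m Cm" and sets: "sets m = sets borel" and P: "poincare m CP lam"
      using PI by (auto simp: PI_space_with_def metric_measure_def)
    have const_bounds: "Cm > 0" "CP > 0" "CE \<ge> 1"
      using dbl P ext by (auto simp: doubling_def poincare_def BV_extension_with_def)
    have "r > 0" using const_bounds by (simp add: r_def)
    have r: "16 * (CP * r * Cm ^ p) * CE \<le> 1" using const_bounds by (simp add: r_def field_simps)
    have k': "2 * R \<le> 2 ^ k * r" using k \<open>r > 0\<close> by (simp add: field_simps)
    let ?V = "measure m (ball x0 R)"
    have "?V > 0" by (rule doubling_ball_pos[OF dbl \<open>R > 0\<close>])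
    have fm: "A \<in> fmeasurable m" if "A \<subseteq> ball x0 R" "A \<in> sets borel" for A
      using that doubling_ball_finite[OF dbl \<open>R > 0\<close>, of x0] emeasure_mono[of A "ball x0 R" m]
      by (auto simp: fmeasurable_def sets)
    have sub: "Ei i \<subseteq> E" if "i \<in> {1..M}" for i using cover that by blast
    have piece: "?V \<le> Q * measure m (Ei i)" if i: "i \<in> {1..M}" for i
    proof -
      have "Ei i \<subseteq> ball x0 R" using sub[OF i] R by blast
      with fm borel[OF i] have fin: "emeasure m (Ei i) < \<infinity>" by (simp add: fmeasurable_def)
      obtain v where "v \<in> borel_measurable m" "AE y in m. y \<in> Ei i \<longrightarrow> v y = 1"
        "(\<integral>\<^sup>+y. ennreal \<bar>v y\<bar> \<partial>m) \<le> ennreal CE * emeasure m (Ei i)"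
        "tot_var m v UNIV \<le> ennreal CE * emeasure m (Ei i)"
        by (rule BV_extension_of_piece[OF sets ext borel[OF i] sub[OF i] fin per[OF i]])
      from volume_lower_bound[OF dbl sets P borel[OF i] \<open>Ei i \<subseteq> ball x0 R\<close> pos[OF i] this
          const_bounds(3) \<open>R > 0\<close> \<open>r > 0\<close> _ r k'] p
      show ?thesis by (simp add: Q_def)
    qed
    have "real M * ?V = (\<Sum>i\<in>{1..M}. ?V)" by simp
    also have "\<dots> \<le> (\<Sum>i\<in>{1..M}. Q * measure m (Ei i))" by (intro sum_mono piece)
    also have "\<dots> = Q * measure m E"
    proof -
      have "measure m (\<Union>i\<in>{1..M}. Ei i) = (\<Sum>i\<in>{1..M}. measure m (Ei i))"
      proof (intro measure_finite_Union disj)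
        fix i assume i: "i \<in> {1..M}"
        then have "Ei i \<subseteq> ball x0 R" using sub R by blast
        with fm[of "Ei i"] borel[OF i] show "emeasure m (Ei i) \<noteq> \<infinity>"
          by (auto simp: fmeasurable_def)
      qed (use borel in \<open>auto simp: sets\<close>)
      then show ?thesis unfolding cover by (simp add: sum_distrib_left)
    qed
    also have "\<dots> \<le> Q * ?V"
      using R const_bounds fm[of "ball x0 R"] \<open>closed E\<close>
      by (intro mult_left_mono measure_mono_fmeasurable) (auto simp: Q_def sets)
    finally have "real M \<le> Q" using \<open>?V > 0\<close> by simp
    then show ?thesis by linarith
  qed
  show ?thesis
  proof (intro exI[of _ "nat \<lfloor>Q\<rfloor>"] allI impI, elim conjE)
    fix m :: "'a measure" and M :: nat and Ei
    assume "PI_space_with m Cm CP lam" "BV_extension_with m E CE"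
      "\<forall>i\<in>{1..M}. Ei i \<in> sets borel" "disjoint_family_on Ei {1..M}" "(\<Union>i\<in>{1..M}. Ei i) = E"
      "\<forall>i\<in>{1..M}. emeasure m (Ei i) > 0 \<and> perimeter m E (Ei i) E = 0"
    then show "M \<le> nat \<lfloor>Q\<rfloor>" by (intro bound[of m M Ei]) blast+
  qed
qed

end
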